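(* Let $n\ge 0$ be an integer, let $s\in\mathbb{C}$, let $a\in\mathbb{C}$ with $\Re(a)>0$, and put $q=\frac{a}{4}+\frac14$ (so $2q=\frac{a+1}{2}$). Then $$\int_{0}^{\infty}\frac{v^{2n}\,\cos\!\left(s\arctan\!\left(\frac{2v}{a}\right)\right)}{(a^{2}+4v^{2})^{s/2}\cosh(\pi v)}\,dv=2^{-s}(-1)^{n}\left(\frac{a}{2}\right)^{2n}\Gamma(2n+1)\sum_{j=0}^{2n}\frac{(-2/a)^{j}\,\eta(s-j,2q)}{\Gamma(2n-j+1)\,\Gamma(j+1)} .$$
   Context: $\eta(s,x)$ is the alternating Hurwitz zeta function, $\eta(s,x)=\sum_{k=0}^{\infty}\frac{(-1)^k}{(k+x)^s}$ for $\Re(x)>0$ (convergent for $\Re(s)>0$), extended to all $s\in\mathbb{C}$ by analytic continuation in $s$ (it is entire in $s$). All powers and $\arctan$ take their principal values. *)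

theory Defs
  imports "HOL-Complex_Analysis.Complex_Analysis"
begin

text \<open>
  The alternating Hurwitz zeta function, meaningful for \<open>Re x > 0\<close>: for fixed \<open>x\<close> it is the
  entire function of \<open>s\<close> that continues the series. The series converges only conditionally
  for \<open>0 < Re s \<le> 1\<close>, hence \<open>sums\<close>. The continuation is unique by the identity theorem; its
  existence is a fact to be proved, as the definite description does not presuppose it.
\<close>

definition alt_hurwitz_zeta :: "complex \<Rightarrow> complex \<Rightarrow> complex" where
  "alt_hurwitz_zeta s x =
     (THE f. f holomorphic_on UNIV \<and>
        (\<forall>z. Re z > 0 \<longrightarrow> (\<lambda>k. (-1) ^ k / (of_nat k + x) powr z) sums f z)) s"

end

theory Submission
  imports Defs
begin

text \<open>
  Put \<open>b = a/2\<close>. Since \<open>a + 2iv\<close> and \<open>a - 2iv\<close> both lie in the right half plane, their logarithms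
  add and subtract without crossing a branch cut. Hence \<open>cos (s arctan (2v/a)) / (a\<^sup>2 + 4v\<^sup>2)^(s/2)\<close> is
  the even part of \<open>(a + 2iv)^(-s)\<close> as a function of \<open>v\<close>, and the integral over the half line becomes
  half of an integral over the whole line (\<open>cos_Arctan_over_powr\<close>, \<open>even_part_has_integral\<close>).

  Expanding \<open>v^(2n)\<close> in powers of \<open>b + iv\<close> by the binomial theorem turns the factor \<open>v^(2n)\<close> into
  shifts \<open>s \<mapsto> s - j\<close> of the exponent (\<open>sech_power_moment_has_integral\<close>). What remains is the case
  \<open>n = 0\<close>, namely that for all complex \<open>s\<close>
  \[ \eta(s, b + 1/2) = \frac12 \int_{-\infty}^{\infty} \frac{(b + iv)^{-s}}{\cosh \pi v}\,dv. \]

  The right-hand side is entire in \<open>s\<close>, because \<open>(b + iv)^(-s)\<close> grows subexponentially in \<open>v\<close>,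
  uniformly for bounded \<open>s\<close>, while \<open>1 / cosh (\<pi>v)\<close> decays exponentially
  (\<open>sech_power_integral_entire\<close>). So the integral itself provides the analytic continuation, once it
  is known to be the sum of the alternating series for \<open>Re s > 0\<close>. Writing \<open>J(b)\<close> for the integral,
  the residue theorem on a strip of width 1 around the single pole \<open>b + 1/2\<close> gives
  \<open>J(b) + J(b + 1) = 2 (b + 1/2)^(-s)\<close> (\<open>sech_power_integral_plus_shift\<close>). The partial sums of the
  series therefore telescope, with remainder \<open>J(b + N) / 2\<close> up to sign, which tends to 0 for \<open>Re s > 0\<close>.
  This reaches the conditionally convergent range \<open>0 < Re s \<le> 1\<close> with no separate argument.
\<close>

section \<open>Integrands dominated by a decaying exponential\<close>

lemma exp_neg_abs_integrable:
  assumes "S \<in> sets lebesgue"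
  shows "(\<lambda>v::real. exp (- \<bar>v\<bar>)) integrable_on S"
proof -
  have pos: "(\<lambda>v::real. exp (- \<bar>v\<bar>)) absolutely_integrable_on {0..}"
  proof (rule nonnegative_absolutely_integrable_1)
    have "(\<lambda>v::real. exp (-1 * v)) integrable_on {0..}"
      by (rule integrable_on_exp_minus_to_infinity) simp
    thus "(\<lambda>v::real. exp (- \<bar>v\<bar>)) integrable_on {0..}"
      by (rule integrable_eq) auto
  qed auto
  have "(\<lambda>v::real. exp (- \<bar>-v\<bar>)) absolutely_integrable_on {..0} \<and>
        integral {..0} (\<lambda>v::real. exp (- \<bar>-v\<bar>)) = integral {0..} (\<lambda>v::real. exp (- \<bar>v\<bar>))"
    by (subst has_absolute_integral_reflect_real[of "{..0}" "{0..}"]) (use pos in auto)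
  hence neg: "(\<lambda>v::real. exp (- \<bar>v\<bar>)) absolutely_integrable_on {..0}" by simp
  have "(\<lambda>v::real. exp (- \<bar>v\<bar>)) absolutely_integrable_on ({..0} \<union> {0..})"
    by (rule absolutely_integrable_Un) (use pos neg in auto)
  hence "(\<lambda>v::real. exp (- \<bar>v\<bar>)) absolutely_integrable_on S"
    by (rule set_integrable_subset) (use assms in auto)
  thus ?thesis by (simp add: absolutely_integrable_on_def)
qed

lemma exp_dominated_integrable:
  fixes g :: "real \<Rightarrow> complex"
  assumes "continuous_on UNIV g" "\<And>v. norm (g v) \<le> C * exp (- \<bar>v\<bar>)" "S \<in> sets lebesgue"
  shows "g integrable_on S"
proof (rule measurable_bounded_by_integrable_imp_integrable)
  show "g \<in> borel_measurable (lebesgue_on S)"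
    using assms(1,3) continuous_imp_measurable_on_sets_lebesgue continuous_on_subset by blast
  show "(\<lambda>v. C * exp (- \<bar>v\<bar>)) integrable_on S"
    using exp_neg_abs_integrable[OF assms(3)] by (rule integrable_on_mult_right)
qed (use assms in auto)

lemma exp_dominated_integral_norm_le:
  fixes g :: "real \<Rightarrow> complex"
  assumes "continuous_on UNIV g" "\<And>v. norm (g v) \<le> C * exp (- \<bar>v\<bar>)" "S \<in> sets lebesgue"
  shows "norm (integral S g) \<le> C * integral S (\<lambda>v. exp (- \<bar>v\<bar>))"
proof -
  have "norm (integral S g) \<le> integral S (\<lambda>v. C * exp (- \<bar>v\<bar>))"
    using assms exp_neg_abs_integrable[OF assms(3)]
    by (intro Henstock_Kurzweil_Integration.integral_norm_bound_integral exp_dominated_integrable[OF assms]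
        integrable_on_mult_right) auto
  thus ?thesis by simp
qed

text \<open>
  The bound depends on \<open>g\<close> only through \<open>C\<close>, so it is uniform over any family of integrands with a
  common majorant; this is what makes the limit in \<open>sech_power_integral_entire\<close>
  locally uniform.
\<close>

lemma exp_dominated_truncation_error:
  fixes g :: "real \<Rightarrow> complex"
  assumes "continuous_on UNIV g" "\<And>v. norm (g v) \<le> C * exp (- \<bar>v\<bar>)" "S \<in> sets lebesgue"
  shows "norm (integral (S \<inter> {-real k..real k}) g - integral S g)
           \<le> C * integral (S - {-real k..real k}) (\<lambda>v. exp (- \<bar>v\<bar>))"
proof -
  let ?K = "{-real k..real k}"
  have meas: "S \<inter> ?K \<in> sets lebesgue" "S - ?K \<in> sets lebesgue" using assms(3) by auto
  have "integral (S \<inter> ?K \<union> (S - ?K)) g = integral (S \<inter> ?K) g + integral (S - ?K) g"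
    by (rule integral_Un) (use meas in \<open>auto intro!: exp_dominated_integrable[OF assms(1,2)]
         intro: negligible_subset[of "{}"]\<close>)
  moreover have "S \<inter> ?K \<union> (S - ?K) = S" by auto
  ultimately have "integral S g = integral (S \<inter> ?K) g + integral (S - ?K) g" by simp
  thus ?thesis using exp_dominated_integral_norm_le[OF assms(1,2) meas(2)] by simp
qed

lemma exp_neg_abs_tail_tendsto_0:
  assumes "S \<in> sets lebesgue"
  shows "(\<lambda>k. integral (S - {-real k..real k}) (\<lambda>v::real. exp (- \<bar>v\<bar>))) \<longlonglongrightarrow> 0"
proof -
  let ?f = "\<lambda>k v::real. if v \<in> - {-real k..real k} then exp (- \<bar>v\<bar>) else 0"
  have "(\<lambda>k. integral S (?f k)) \<longlonglongrightarrow> integral S (\<lambda>v. 0 :: real)"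
  proof (rule dominated_convergence(2)[OF _ exp_neg_abs_integrable[OF assms]])
    show "?f k integrable_on S" for k
      unfolding integrable_restrict_Int using assms by (intro exp_neg_abs_integrable) auto
    show "(\<lambda>k. ?f k v) \<longlonglongrightarrow> 0" for v
    proof (rule tendsto_eventually)
      obtain m where "\<bar>v\<bar> \<le> real m" using real_arch_simple by blast
      thus "eventually (\<lambda>k. ?f k v = 0) sequentially"
        by (intro eventually_sequentiallyI[of m]) auto
    qed
  qed auto
  thus ?thesis unfolding integral_restrict_Int by (simp add: Diff_eq Int_commute)
qed

lemma exp_dominated_truncation_tendsto:
  fixes g :: "real \<Rightarrow> complex"
  assumes "continuous_on UNIV g" "\<And>v. norm (g v) \<le> C * exp (- \<bar>v\<bar>)" "S \<in> sets lebesgue"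
  shows "(\<lambda>k. integral (S \<inter> {-real k..real k}) g) \<longlonglongrightarrow> integral S g"
proof (rule LIM_zero_cancel, rule Lim_null_comparison)
  show "\<forall>\<^sub>F k in sequentially. norm (integral (S \<inter> {-real k..real k}) g - integral S g)
           \<le> C * integral (S - {-real k..real k}) (\<lambda>v. exp (- \<bar>v\<bar>))"
    using exp_dominated_truncation_error[OF assms] by simp
  show "(\<lambda>k. C * integral (S - {-real k..real k}) (\<lambda>v. exp (- \<bar>v\<bar>))) \<longlonglongrightarrow> 0"
    using tendsto_mult_right_zero[OF exp_neg_abs_tail_tendsto_0[OF assms(3)]] .
qed

text \<open>
  Both sides are limits of integrals over bounded intervals, where the reflection \<open>v \<mapsto> -v\<close> folds
  \<open>[-k, k]\<close> onto \<open>[0, k]\<close>.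
\<close>

lemma even_part_has_integral:
  fixes p :: "real \<Rightarrow> complex"
  assumes cont: "continuous_on UNIV p" and bound: "\<And>v. norm (p v) \<le> C * exp (- \<bar>v\<bar>)"
  shows "((\<lambda>v. (p v + p (-v)) / 2) has_integral (integral UNIV p / 2)) {0..}"
proof -
  define e where "e = (\<lambda>v. (p v + p (-v)) / 2)"
  have conte: "continuous_on UNIV e"
    unfolding e_def using cont by (auto intro!: continuous_intros continuous_on_compose2[OF cont])
  have bounde: "norm (e v) \<le> C * exp (- \<bar>v\<bar>)" for v
    using norm_triangle_ineq[of "p v" "p (-v)"] bound[of v] bound[of "-v"]
    by (simp add: e_def norm_divide)
  have int: "p integrable_on {a..b}" "(\<lambda>v. p (-v)) integrable_on {a..b}" for a b
    by (auto intro!: integrable_continuous_real continuous_intros continuous_on_compose2[OF cont]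
        continuous_on_subset[OF cont])
  have half: "integral {0..real k} e = integral {-real k..real k} p / 2" for k
  proof -
    have "integral {0..real k} e = (integral {0..real k} p + integral {0..real k} (\<lambda>v. p (-v))) / 2"
      unfolding e_def by (simp add: integral_add int)
    also have "integral {0..real k} (\<lambda>v. p (-v)) = integral {-real k..0} p"
      using Henstock_Kurzweil_Integration.integral_reflect_real[where b = 0 and a = "- real k" and f = p]
      by (simp del: Henstock_Kurzweil_Integration.integral_reflect_real)
    also have "integral {0..real k} p + \<dots> = integral {-real k..real k} p"
      using Henstock_Kurzweil_Integration.integral_combine[where a = "- real k" and c = 0 and b = "real k" and f = p] int
      by (simp add: add.commute)
    finally show ?thesis .
  qed
  have "(\<lambda>k. integral ({0..} \<inter> {-real k..real k}) e) \<longlonglongrightarrow> integral {0..} e"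
    by (rule exp_dominated_truncation_tendsto[OF conte bounde]) auto
  also have "(\<lambda>k. integral ({0..} \<inter> {-real k..real k}) e) = (\<lambda>k. integral {-real k..real k} p / 2)"
    unfolding half[symmetric] by (intro ext arg_cong2[of _ _ _ _ integral]) auto
  finally have lim1: "(\<lambda>k. integral {-real k..real k} p / 2) \<longlonglongrightarrow> integral {0..} e" .
  have "(\<lambda>k. integral (UNIV \<inter> {-real k..real k}) p) \<longlonglongrightarrow> integral UNIV p"
    by (rule exp_dominated_truncation_tendsto[OF cont bound]) auto
  hence "(\<lambda>k. integral {-real k..real k} p / 2) \<longlonglongrightarrow> integral UNIV p / 2"
    by (auto intro: tendsto_divide)
  with lim1 have "integral {0..} e = integral UNIV p / 2" by (rule LIMSEQ_unique)
  moreover have "e integrable_on {0..}"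
    by (rule exp_dominated_integrable[OF conte bounde]) auto
  ultimately show ?thesis unfolding e_def by (metis integrable_integral)
qed

section \<open>Growth of complex powers on vertical lines\<close>

lemma exp_two_abs_le_cosh: "exp (2 * \<bar>v\<bar>) \<le> 2 * cosh (pi * v :: real)"
proof -
  have "exp (2 * \<bar>v\<bar>) \<le> exp (pi * \<bar>v\<bar>)"
    using pi_ge_two by (simp add: mult_right_mono)
  also have "\<dots> \<le> exp (pi * v) + exp (- (pi * v))"
    by (cases "v \<ge> 0") (auto simp: abs_if)
  finally show ?thesis by (simp add: cosh_def)
qed

text \<open>
  The factor \<open>1 / cosh (\<pi>v)\<close> absorbs growth up to \<open>exp \<bar>v\<bar>\<close> and still leaves the decay
  \<open>exp (-\<bar>v\<bar>)\<close> that the majorants above require.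
\<close>

lemma divide_cosh_norm_le:
  assumes "norm z \<le> C * exp \<bar>v\<bar>"
  shows "norm (z / of_real (cosh (pi * v)) :: complex) \<le> 2 * C * exp (- \<bar>v\<bar>)"
proof -
  have C: "C \<ge> 0" using order_trans[OF norm_ge_zero assms] by (simp add: zero_le_mult_iff)
  have "norm z * exp \<bar>v\<bar> \<le> C * exp (2 * \<bar>v\<bar>)"
    using mult_right_mono[OF assms, of "exp \<bar>v\<bar>"] by (simp add: mult.assoc flip: exp_add)
  also have "\<dots> \<le> C * (2 * cosh (pi * v))"
    using exp_two_abs_le_cosh C by (intro mult_left_mono)
  finally show ?thesis
    by (simp add: norm_divide exp_minus field_simps)
qed

lemma not_nonpos_Reals_if_Re_pos: "Re z > 0 \<Longrightarrow> z \<notin> \<real>\<^sub>\<le>\<^sub>0"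
  by (auto simp: complex_nonpos_Reals_iff)

text \<open>
  The modulus \<open>\<bar>b + iv\<bar>\<close> is bounded below by \<open>Re b\<close> and grows only linearly, so the logarithm grows
  more slowly than any multiple of \<open>\<bar>v\<bar>\<close>. Exponentiating makes \<open>(b + iv)^s\<close> subexponential in \<open>v\<close>,
  uniformly for bounded \<open>s\<close>.
\<close>

lemma norm_Ln_vertical_line_le:
  fixes b :: complex and R :: real
  assumes b: "Re b > 0" and R: "R > 0"
  shows "\<exists>C. \<forall>v. R * norm (Ln (b + \<i> * of_real v)) \<le> C + \<bar>v\<bar>"
proof (intro exI allI)
  fix v :: real
  let ?z = "b + \<i> * of_real v"
  have lo: "Re b \<le> norm ?z" using complex_Re_le_cmod[of ?z] by simp
  have hi: "norm ?z \<le> norm b + \<bar>v\<bar>" using norm_triangle_ineq[of b "\<i> * of_real v"] by (simp add: norm_mult)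
  have nz: "?z \<noteq> 0" using b by (auto simp: complex_eq_iff)
  have pos: "norm ?z > 0" using nz by simp
  have "norm (Ln ?z) \<le> \<bar>Re (Ln ?z)\<bar> + \<bar>Im (Ln ?z)\<bar>" by (rule cmod_le)
  also have "\<dots> \<le> \<bar>ln (norm ?z)\<bar> + pi"
    using nz mpi_less_Im_Ln[OF nz] Im_Ln_le_pi[OF nz] by (simp add: Re_Ln)
  finally have 1: "norm (Ln ?z) \<le> \<bar>ln (norm ?z)\<bar> + pi" .
  \<comment> \<open>The tangent of \<open>ln\<close> at \<open>R\<close>: its slope \<open>1 / R\<close> cancels the factor \<open>R\<close>.\<close>
  have "ln (norm ?z / R) \<le> norm ?z / R - 1"
    using pos R by (intro ln_le_minus_one) auto
  hence up: "ln (norm ?z) \<le> ln R + norm ?z / R"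
    using pos R by (simp add: ln_div)
  have down: "ln (norm ?z) \<ge> ln (Re b)" using lo b pos by (subst ln_le_cancel_iff) auto
  have "\<bar>ln (norm ?z)\<bar> \<le> \<bar>ln (Re b)\<bar> + \<bar>ln R\<bar> + norm ?z / R"
    using up down divide_nonneg_pos[of "norm ?z" R] pos R by linarith
  with 1 have "norm (Ln ?z) \<le> \<bar>ln (Re b)\<bar> + \<bar>ln R\<bar> + pi + norm ?z / R" by simp
  hence "R * norm (Ln ?z) \<le> R * (\<bar>ln (Re b)\<bar> + \<bar>ln R\<bar> + pi + norm ?z / R)"
    using R by simp
  also have "\<dots> = R * (\<bar>ln (Re b)\<bar> + \<bar>ln R\<bar> + pi) + norm ?z" using R by (simp add: field_simps)
  finally show "R * norm (Ln ?z) \<le> (R * (\<bar>ln (Re b)\<bar> + \<bar>ln R\<bar> + pi) + norm b) + \<bar>v\<bar>"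
    using hi by simp
qed

lemma norm_powr_vertical_line_le:
  fixes b :: complex and R :: real
  assumes b: "Re b > 0"
  shows "\<exists>C. \<forall>s v. norm s \<le> R \<longrightarrow> norm ((b + \<i> * of_real v) powr s) \<le> C * exp \<bar>v\<bar>"
proof -
  have "max R 1 > 0" by simp
  from norm_Ln_vertical_line_le[OF b this] obtain C where
    C: "\<And>v. max R 1 * norm (Ln (b + \<i> * of_real v)) \<le> C + \<bar>v\<bar>" by blast
  have "norm ((b + \<i> * of_real v) powr s) \<le> exp C * exp \<bar>v\<bar>" if "norm s \<le> R" for s v
  proof -
    have nz: "b + \<i> * of_real v \<noteq> 0" using b by (auto simp: complex_eq_iff)
    have "norm (s * Ln (b + \<i> * of_real v)) \<le> max R 1 * norm (Ln (b + \<i> * of_real v))"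
      using that by (simp add: norm_mult mult_right_mono)
    also note C
    finally have "exp (norm (s * Ln (b + \<i> * of_real v))) \<le> exp (C + \<bar>v\<bar>)" by simp
    with norm_exp[of "s * Ln (b + \<i> * of_real v)"]
    have "norm (exp (s * Ln (b + \<i> * of_real v))) \<le> exp (C + \<bar>v\<bar>)" by (rule order_trans)
    thus ?thesis using nz by (simp add: powr_def exp_add)
  qed
  thus ?thesis by blast
qed

section \<open>The integral of a complex power against the hyperbolic secant\<close>

definition sech_power_integral :: "complex \<Rightarrow> complex \<Rightarrow> complex" where
  "sech_power_integral b s =
     integral UNIV (\<lambda>v. (b + \<i> * of_real v) powr (-s) / of_real (cosh (pi * v)))"

lemma sech_power_integrand_continuous:
  assumes "Re b > 0"
  shows "continuous_on UNIV (\<lambda>v. (b + \<i> * of_real v) powr s / of_real (cosh (pi * v)))"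
  using assms
  by (auto intro!: continuous_intros not_nonpos_Reals_if_Re_pos simp: powr_def complex_eq_iff)

lemma sech_power_integrand_bound:
  assumes "Re b > 0"
  shows "\<exists>C. \<forall>s v. norm s \<le> R \<longrightarrow>
    norm ((b + \<i> * of_real v) powr s / of_real (cosh (pi * v))) \<le> C * exp (- \<bar>v\<bar>)"
  using norm_powr_vertical_line_le[OF assms, of R] divide_cosh_norm_le by meson

lemma sech_power_truncation_holomorphic:
  assumes "Re b > 0"
  shows "(\<lambda>s. integral {-real k..real k}
            (\<lambda>v. (b + \<i> * of_real v) powr (-s) / of_real (cosh (pi * v)))) holomorphic_on UNIV"
proof -
  have "(\<lambda>s. integral (cbox (-real k) (real k))
            (\<lambda>v. (b + \<i> * of_real v) powr (-s) / of_real (cosh (pi * v)))) holomorphic_on UNIV"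
  proof (rule leibniz_rule_holomorphic[where fx = "\<lambda>s v. - Ln (b + \<i> * of_real v) *
           (b + \<i> * of_real v) powr (-s) / of_real (cosh (pi * v))"])
    fix s :: complex and v :: real
    have "b + \<i> * of_real v \<noteq> 0" using assms by (auto simp: complex_eq_iff)
    thus "((\<lambda>s. (b + \<i> * of_real v) powr (-s) / of_real (cosh (pi * v))) has_field_derivative
      - Ln (b + \<i> * of_real v) * (b + \<i> * of_real v) powr (-s) / of_real (cosh (pi * v)))
      (at s within UNIV)"
      unfolding powr_def by (auto intro!: derivative_eq_intros simp: field_simps)
  next
    show "(\<lambda>v. (b + \<i> * of_real v) powr (-s) / of_real (cosh (pi * v))) integrable_on
            cbox (-real k) (real k)" for s
      by (rule integrable_continuous, rule continuous_on_subset[OF sech_power_integrand_continuous])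
         (use assms in auto)
    show "continuous_on (UNIV \<times> cbox (-real k) (real k)) (\<lambda>(s, v). - Ln (b + \<i> * of_real v) *
           (b + \<i> * of_real v) powr (-s) / of_real (cosh (pi * v)))"
      unfolding case_prod_beta using assms
      by (auto intro!: continuous_intros not_nonpos_Reals_if_Re_pos simp: complex_eq_iff powr_def)
  qed auto
  thus ?thesis by simp
qed

text \<open>
  Locally uniform limit of the integrals over \<open>[-k, k]\<close>, which are holomorphic by differentiation
  under the integral sign.
\<close>

lemma sech_power_integral_entire:
  assumes b: "Re b > 0"
  shows "sech_power_integral b holomorphic_on UNIV"
proof (rule holomorphic_uniform_sequence[OF open_UNIV sech_power_truncation_holomorphic[OF b]])
  fix s0 :: complex
  let ?T = "\<lambda>k s. integral {-real k..real k}
              (\<lambda>v. (b + \<i> * of_real v) powr (-s) / of_real (cosh (pi * v)))"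
  obtain C where C: "\<And>s v. norm s \<le> norm s0 + 1 \<Longrightarrow>
      norm ((b + \<i> * of_real v) powr s / of_real (cosh (pi * v))) \<le> C * exp (- \<bar>v\<bar>)"
    using sech_power_integrand_bound[OF b] by blast
  define tail where "tail = (\<lambda>k. C * integral (UNIV - {-real k..real k}) (\<lambda>v::real. exp (- \<bar>v\<bar>)))"
  have tail: "tail \<longlonglongrightarrow> 0"
    unfolding tail_def using tendsto_mult_right_zero[OF exp_neg_abs_tail_tendsto_0[of UNIV]] by simp
  have err: "norm (?T k s - sech_power_integral b s) \<le> tail k" if "s \<in> cball s0 1" for s k
  proof -
    have "norm (-s) \<le> norm s0 + 1"
      using that norm_triangle_ineq4[of s0 "s0 - s"] by (simp add: dist_norm)
    from exp_dominated_truncation_error[OF sech_power_integrand_continuous[OF b] C[OF this], of UNIV k]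
    show ?thesis by (simp add: tail_def sech_power_integral_def)
  qed
  have "uniform_limit (cball s0 1) ?T (sech_power_integral b) sequentially"
  proof (rule uniform_limitI)
    fix e :: real assume "e > 0"
    with tail have "eventually (\<lambda>k. tail k < e) sequentially" by (rule order_tendstoD)
    thus "\<forall>\<^sub>F k in sequentially. \<forall>s\<in>cball s0 1. dist (?T k s) (sech_power_integral b s) < e"
      by eventually_elim (use err in \<open>auto simp: dist_norm simp del: mem_cball intro: le_less_trans\<close>)
  qed
  thus "\<exists>d. 0 < d \<and> cball s0 d \<subseteq> UNIV \<and> uniform_limit (cball s0 d) ?T (sech_power_integral b) sequentially"
    by (intro exI[of _ 1]) auto
qed

text \<open>
  For \<open>Re s > 0\<close> the power decreases with the modulus, and the argument contributes only a constant
  factor. Hence powers are bounded on half planes \<open>Re z \<ge> r\<close>, and the bound tends to 0 as \<open>r\<close> grows.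
\<close>

lemma norm_powr_right_half_plane_le:
  assumes "0 < r" "r \<le> Re z" "Re s > 0"
  shows "norm (z powr (-s)) \<le> r powr (- Re s) * exp (\<bar>Im s\<bar> * pi)"
proof -
  have "r \<le> norm z" using assms(2) complex_Re_le_cmod[of z] by linarith
  hence 1: "norm z powr (- Re s) \<le> r powr (- Re s)" using assms by (intro powr_mono2') auto
  have "Im s * Arg z \<le> \<bar>Im s\<bar> * \<bar>Arg z\<bar>" using abs_ge_self[of "Im s * Arg z"] by (simp add: abs_mult)
  also have "\<dots> \<le> \<bar>Im s\<bar> * pi" using Arg_bounded[of z] by (intro mult_left_mono) auto
  finally show ?thesis unfolding norm_powr_complex using 1 by (intro mult_mono) auto
qed

lemma sech_power_integral_shift_tendsto_0:
  assumes b: "Re b > 0" and s: "Re s > 0"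
  shows "(\<lambda>N. sech_power_integral (b + of_nat N) s) \<longlonglongrightarrow> 0"
proof (rule Lim_null_comparison)
  let ?I = "integral UNIV (\<lambda>v::real. exp (- \<bar>v\<bar>))"
  let ?B = "\<lambda>N. 2 * ((Re b + real N) powr (- Re s) * exp (\<bar>Im s\<bar> * pi)) * ?I"
  have "norm (sech_power_integral (b + of_nat N) s) \<le> ?B N" for N
    unfolding sech_power_integral_def
  proof (rule exp_dominated_integral_norm_le)
    show "continuous_on UNIV (\<lambda>v. (b + of_nat N + \<i> * of_real v) powr - s / of_real (cosh (pi * v)))"
      by (rule sech_power_integrand_continuous) (use b in auto)
    fix v :: real
    have "norm ((b + of_nat N + \<i> * of_real v) powr - s) \<le> (Re b + real N) powr (- Re s) * exp (\<bar>Im s\<bar> * pi)"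
      by (rule norm_powr_right_half_plane_le) (use b s in auto)
    also have "\<dots> \<le> (Re b + real N) powr (- Re s) * exp (\<bar>Im s\<bar> * pi) * exp \<bar>v\<bar>"
      using mult_left_mono[of 1 "exp \<bar>v\<bar>" "(Re b + real N) powr (- Re s) * exp (\<bar>Im s\<bar> * pi)"]
      by simp
    finally show "norm ((b + of_nat N + \<i> * of_real v) powr - s / of_real (cosh (pi * v)))
       \<le> 2 * ((Re b + real N) powr (- Re s) * exp (\<bar>Im s\<bar> * pi)) * exp (- \<bar>v\<bar>)"
      by (rule divide_cosh_norm_le)
  qed auto
  thus "\<forall>\<^sub>F N in sequentially. norm (sech_power_integral (b + of_nat N) s) \<le> ?B N" by simp
  have "filterlim (\<lambda>N. Re b + real N) at_top sequentially"
    by (rule filterlim_tendsto_add_at_top[OF tendsto_const filterlim_real_sequentially])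
  from tendsto_neg_powr[OF _ this, of "- Re s"] s
  have "(\<lambda>N. (Re b + real N) powr (- Re s)) \<longlonglongrightarrow> 0" by simp
  from tendsto_mult_left_zero[OF this, of "2 * exp (\<bar>Im s\<bar> * pi) * ?I"]
  show "?B \<longlonglongrightarrow> 0" by (simp add: mult_ac)
qed

section \<open>The functional equation, by residues\<close>

lemma sinh_abs_Im_le_norm_sin: "sinh \<bar>Im z\<bar> \<le> norm (sin z)"
proof -
  have eq: "norm (sin z) = norm (exp (\<i> * z) - exp (- (\<i> * z))) / 2"
    by (simp add: sin_exp_eq norm_divide norm_mult)
  have n: "norm (exp (\<i> * z)) = exp (- Im z)" "norm (exp (- (\<i> * z))) = exp (Im z)" by simp_all
  have "\<bar>exp (- Im z) - exp (Im z)\<bar> \<le> norm (exp (\<i> * z) - exp (- (\<i> * z)))"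
    using norm_triangle_ineq3[of "exp (\<i> * z)" "exp (- (\<i> * z))"] unfolding n .
  moreover have "sinh \<bar>Im z\<bar> = \<bar>exp (- Im z) - exp (Im z)\<bar> / 2"
    by (cases "Im z \<ge> 0") (auto simp: sinh_def abs_if field_simps)
  ultimately show ?thesis unfolding eq by simp
qed

lemma sin_pi_half_plus_imaginary: "sin (of_real pi * (1/2 + \<i> * of_real v)) = of_real (cosh (pi * v))"
  and sin_pi_minus_half_plus_imaginary: "sin (of_real pi * (-1/2 + \<i> * of_real v)) = - of_real (cosh (pi * v))"
proof -
  have c: "cos (\<i> * of_real (pi * v)) = (of_real (cosh (pi * v)) :: complex)"
    unfolding cosh_conv_cos[symmetric]
    by (simp only: cosh_field_def of_real_divide of_real_add of_real_numeral exp_of_real[symmetric] of_real_minus)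
  have h: "sin (of_real (pi / 2)) = (1 :: complex)" "cos (of_real (pi / 2)) = (0 :: complex)"
    by (simp_all only: sin_of_real cos_of_real sin_pi_half cos_pi_half of_real_1 of_real_0)
  have "of_real pi * (1/2 + \<i> * of_real v) = \<i> * of_real (pi * v) + of_real (pi / 2)"
    by (simp add: algebra_simps)
  thus "sin (of_real pi * (1/2 + \<i> * of_real v)) = of_real (cosh (pi * v))"
    by (simp only: sin_add c h) simp
  have "of_real pi * (-1/2 + \<i> * of_real v) = \<i> * of_real (pi * v) - of_real (pi / 2)"
    by (simp add: algebra_simps)
  thus "sin (of_real pi * (-1/2 + \<i> * of_real v)) = - of_real (cosh (pi * v))"
    by (simp only: sin_diff c h) simp
qed

lemma sin_pi_times_eq_0_iff_strip:
  assumes "\<bar>Re z\<bar> < 1"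
  shows "sin (of_real pi * z) = 0 \<longleftrightarrow> z = 0"
proof
  assume "sin (of_real pi * z) = 0"
  then obtain n where "of_real pi * z = of_real (of_int n * pi)"
    unfolding sin_eq_0 by auto
  hence z: "z = of_int n" by simp
  with assms show "z = 0" by simp
qed auto

text \<open>
  Translating the variable puts the pole at 0. On the lines \<open>Re z = 1/2\<close> and \<open>Re z = -1/2\<close> the
  function \<open>sin (\<pi>z)\<close> restricts to \<open>cosh (\<pi>v)\<close> and \<open>- cosh (\<pi>v)\<close>, which is why it replaces the
  hyperbolic cosine here.
\<close>

lemma residue_powr_over_sin:
  assumes c: "Re c > 0"
  shows "residue (\<lambda>z. (c + z) powr (-s) / sin (of_real pi * z)) 0 = c powr (-s) / pi"
proof -
  define S where "S = {z. -1 < Re z} \<inter> {z. - Re c < Re z} \<inter> {z. Re z < 1}"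
  have oS: "open S" unfolding S_def
    by (intro open_Int open_halfspace_Re_gt open_halfspace_Re_lt)
  have nz: "sin (of_real pi * z) \<noteq> 0" if "z \<in> S - {0}" for z
    using that sin_pi_times_eq_0_iff_strip[of z] by (auto simp: S_def abs_less_iff)
  have np: "c + z \<notin> \<real>\<^sub>\<le>\<^sub>0" if "z \<in> S - {0}" for z
    using that by (intro not_nonpos_Reals_if_Re_pos) (auto simp: S_def)
  show ?thesis
  proof (rule residue_simple'[OF oS])
    show "0 \<in> S" using c by (simp add: S_def)
    show "(\<lambda>z. (c + z) powr (-s) / sin (of_real pi * z)) holomorphic_on S - {0}"
      using nz np by (intro holomorphic_intros) auto
    have "((\<lambda>z. sin (of_real pi * z)) has_field_derivative of_real pi) (at 0)"
      by (auto intro!: derivative_eq_intros)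
    hence "((\<lambda>z. sin (of_real pi * z) / z) \<longlongrightarrow> of_real pi) (at (0::complex))"
      by (simp add: has_field_derivative_iff)
    hence "((\<lambda>z. (c + z) powr (-s) / (sin (of_real pi * z) / z)) \<longlongrightarrow> (c + 0) powr (-s) / pi) (at 0)"
      using c by (intro tendsto_intros tendsto_powr_complex not_nonpos_Reals_if_Re_pos) (auto simp: complex_eq_iff)
    thus "((\<lambda>z. (c + z) powr (-s) / sin (of_real pi * z) * (z - 0)) \<longlongrightarrow> c powr (-s) / pi) (at 0)"
      by simp
  qed
qed

lemma contour_integral_rectpath_split:
  assumes "f contour_integrable_on rectpath a1 a3"
  shows "contour_integral (rectpath a1 a3) f =
     contour_integral (linepath a1 (Complex (Re a3) (Im a1))) f
     + contour_integral (linepath (Complex (Re a3) (Im a1)) a3) f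
     + contour_integral (linepath a3 (Complex (Re a1) (Im a3))) f
     + contour_integral (linepath (Complex (Re a1) (Im a3)) a1) f"
  using assms by (simp add: rectpath_def Let_def add_ac)

text \<open>
  Residue theorem for the rectangle with corners \<open>\<plusminus>1/2 \<plusminus> ik\<close>. The two vertical sides are traversed in
  opposite directions, but \<open>sin (\<pi>z)\<close> also takes opposite signs on them; so they contribute a sum,
  not a difference.
\<close>

lemma rectangle_integral_powr_over_sin:
  fixes b s :: complex and k :: nat
  assumes b: "Re b > 0" and k: "k > 0"
  defines "f \<equiv> \<lambda>z. (b + 1/2 + z) powr (-s) / sin (of_real pi * z)"
  defines "T \<equiv> \<lambda>b. integral {-real k..real k}
            (\<lambda>v. (b + \<i> * of_real v) powr (-s) / of_real (cosh (pi * v)))"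
  shows "\<i> * (T b + T (b + 1))
     + contour_integral (linepath (Complex (-1/2) (-real k)) (Complex (1/2) (-real k))) f
     + contour_integral (linepath (Complex (1/2) (real k)) (Complex (-1/2) (real k))) f
       = 2 * \<i> * (b + 1/2) powr (-s)"
    and "f contour_integrable_on (linepath (Complex (-1/2) (-real k)) (Complex (1/2) (-real k)))"
    and "f contour_integrable_on (linepath (Complex (1/2) (real k)) (Complex (-1/2) (real k)))"
proof -
  \<comment> \<open>A strip that avoids the other zeros of the sine and the branch cut of the power.\<close>
  define S where "S = {z. -1 < Re z} \<inter> {z. - Re (b + 1/2) < Re z} \<inter> {z. Re z < 1}"
  let ?a1 = "Complex (-1/2) (- real k)" and ?a3 = "Complex (1/2) (real k)"
  have oS: "open S" unfolding S_def
    by (intro open_Int open_halfspace_Re_gt open_halfspace_Re_lt)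
  have cS: "connected S" unfolding S_def
    by (intro convex_connected convex_Int convex_halfspace_Re_gt convex_halfspace_Re_lt)
  have box: "cbox ?a1 ?a3 \<subseteq> S" using b by (auto simp: S_def in_cbox_complex_iff)
  have hol: "f holomorphic_on S - {0}" unfolding f_def
  proof (intro holomorphic_intros)
    show "sin (of_real pi * z) \<noteq> 0" if "z \<in> S - {0}" for z
      using that sin_pi_times_eq_0_iff_strip[of z] by (auto simp: S_def abs_less_iff)
    show "b + 1/2 + z \<notin> \<real>\<^sub>\<le>\<^sub>0" if "z \<in> S - {0}" for z
      using that by (intro not_nonpos_Reals_if_Re_pos) (auto simp: S_def)
  qed
  have img: "path_image (rectpath ?a1 ?a3) \<subseteq> S - {0}"
    using box k by (auto simp: path_image_rectpath_cbox_minus_box in_box_complex_iff)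
  have "contour_integral (rectpath ?a1 ?a3) f =
      2 * pi * \<i> * (\<Sum>p\<in>{0}. winding_number (rectpath ?a1 ?a3) p * residue f p)"
  proof (rule Residue_theorem[OF oS cS _ hol _ _ img])
    show "\<forall>z. z \<notin> S \<longrightarrow> winding_number (rectpath ?a1 ?a3) z = 0"
      using box by (auto intro!: winding_number_rectpath_outside)
  qed auto
  also have "(\<Sum>p\<in>{0}. winding_number (rectpath ?a1 ?a3) p * residue f p)
               = winding_number (rectpath ?a1 ?a3) 0 * residue f 0" by simp
  also have "winding_number (rectpath ?a1 ?a3) 0 = 1"
    using k by (intro winding_number_rectpath) (auto simp: in_box_complex_iff)
  also have "residue f 0 = (b + 1/2) powr (-s) / pi"
    unfolding f_def by (rule residue_powr_over_sin) (use b in auto)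
  finally have res: "contour_integral (rectpath ?a1 ?a3) f = 2 * \<i> * (b + 1/2) powr (-s)" by simp
  have cint: "f contour_integrable_on (rectpath ?a1 ?a3)"
    by (rule contour_integrable_holomorphic_simple[OF hol _ _ img]) (use oS in \<open>auto intro: open_delete\<close>)
  show "f contour_integrable_on (linepath ?a1 (Complex (1/2) (-real k)))"
    and "f contour_integrable_on (linepath ?a3 (Complex (-1/2) (real k)))"
    using cint by (auto simp: rectpath_def Let_def)
  have right: "contour_integral (linepath (Complex (1/2) (-real k)) ?a3) f = \<i> * T (b + 1)"
  proof -
    have "f (Complex (1/2) v) = (b + 1 + \<i> * of_real v) powr (-s) / of_real (cosh (pi * v))" for v
      unfolding f_def Complex_eq using sin_pi_half_plus_imaginary[of v] by (simp add: add_ac)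
    thus ?thesis
      using k by (subst contour_integral_linepath_same_Re[of _ "1/2" _ "- real k" "real k"])
                 (auto simp: T_def)
  qed
  have "contour_integral (linepath ?a1 (Complex (-1/2) (real k))) f = - \<i> * T b"
  proof -
    have "f (Complex (-1/2) v) = - ((b + \<i> * of_real v) powr (-s) / of_real (cosh (pi * v)))" for v
      unfolding f_def Complex_eq using sin_pi_minus_half_plus_imaginary[of v] by (simp add: add_ac)
    thus ?thesis
      using k by (subst contour_integral_linepath_same_Re[of _ "-1/2" _ "- real k" "real k"])
                 (auto simp: T_def)
  qed
  moreover have "contour_integral (linepath (Complex (-1/2) (real k)) ?a1) f
      = - contour_integral (linepath ?a1 (Complex (-1/2) (real k))) f"
    using contour_integral_reversepath[of "linepath ?a1 (Complex (-1/2) (real k))" f] by simp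
  ultimately have left: "contour_integral (linepath (Complex (-1/2) (real k)) ?a1) f = \<i> * T b" by simp
  show "\<i> * (T b + T (b + 1))
     + contour_integral (linepath ?a1 (Complex (1/2) (-real k))) f
     + contour_integral (linepath ?a3 (Complex (-1/2) (real k))) f
       = 2 * \<i> * (b + 1/2) powr (-s)"
    using contour_integral_rectpath_split[OF cint] unfolding complex.sel res left right
    by (simp only: ring_distribs ac_simps)
qed

lemma powr_over_sin_norm_le:
  assumes b: "Re b > 0" and s: "Re s > 0" and z: "\<bar>Re z\<bar> \<le> 1/2" "\<bar>Im z\<bar> = real k" "k > 0"
  shows "norm ((b + 1/2 + z) powr (-s) / sin (of_real pi * z))
           \<le> Re b powr (- Re s) * exp (\<bar>Im s\<bar> * pi) / sinh (pi * real k)"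
proof -
  have "sinh (pi * real k) \<le> norm (sin (of_real pi * z))"
    using sinh_abs_Im_le_norm_sin[of "of_real pi * z"] z by (simp add: abs_mult)
  moreover have "norm ((b + 1/2 + z) powr (-s)) \<le> Re b powr (- Re s) * exp (\<bar>Im s\<bar> * pi)"
    by (rule norm_powr_right_half_plane_le) (use assms in auto)
  ultimately show ?thesis unfolding norm_divide using z by (intro frac_le) auto
qed

text \<open>
  Let the height of the rectangle tend to infinity: the power stays bounded because \<open>Re s > 0\<close>, and
  \<open>1 / \<bar>sin (\<pi>z)\<bar> \<le> 1 / sinh (\<pi>k)\<close> on the horizontal sides, so these vanish in the limit.
\<close>

lemma sech_power_integral_plus_shift:
  assumes b: "Re b > 0" and s: "Re s > 0"
  shows "sech_power_integral b s + sech_power_integral (b + 1) s = 2 * (b + 1/2) powr (-s)"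
proof -
  define f where "f = (\<lambda>z. (b + 1/2 + z) powr (-s) / sin (of_real pi * z))"
  define T where "T = (\<lambda>k b. integral {-real k..real k}
            (\<lambda>v. (b + \<i> * of_real v) powr (-s) / of_real (cosh (pi * v))))"
  define M where "M = (\<lambda>k. Re b powr (- Re s) * exp (\<bar>Im s\<bar> * pi) / sinh (pi * real k))"
  have T: "(\<lambda>k. T k b) \<longlonglongrightarrow> sech_power_integral b s" if b: "Re b > 0" for b
  proof -
    obtain C where C: "\<And>v. norm ((b + \<i> * of_real v) powr (-s) / of_real (cosh (pi * v))) \<le> C * exp (- \<bar>v\<bar>)"
      using sech_power_integrand_bound[OF b, of "norm (-s)"] by blast
    from exp_dominated_truncation_tendsto[OF sech_power_integrand_continuous[OF b] C, of UNIV]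
    show ?thesis by (simp add: T_def sech_power_integral_def)
  qed
  have "filterlim (\<lambda>k. sinh (pi * real k)) at_top sequentially"
    by (rule filterlim_compose[OF sinh_real_at_top])
       (rule filterlim_tendsto_pos_mult_at_top[OF tendsto_const pi_gt_zero filterlim_real_sequentially])
  hence M: "M \<longlonglongrightarrow> 0" unfolding M_def
    by (intro tendsto_divide_0[OF tendsto_const] filterlim_at_top_imp_at_infinity)
  have "norm (\<i> * (T k b + T k (b + 1)) - 2 * \<i> * (b + 1/2) powr (-s)) \<le> M k + M k" if k: "k > 0" for k
  proof -
    note rect = rectangle_integral_powr_over_sin[OF b k, of s, folded f_def]
    have alg: "x + y + z = w \<Longrightarrow> x - w = - (y + z)" for x y z w :: complex
      by (drule sym) simp
    let ?bot = "contour_integral (linepath (Complex (-1/2) (-real k)) (Complex (1/2) (-real k))) f"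
    let ?top = "contour_integral (linepath (Complex (1/2) (real k)) (Complex (-1/2) (real k))) f"
    have len: "norm (Complex (1/2) y - Complex (-1/2) y) = 1" "norm (Complex (-1/2) y - Complex (1/2) y) = 1" for y
      by (simp_all add: complex_diff cmod_def)
    have M0: "M k \<ge> 0" using k by (simp add: M_def)
    have bd: "norm (f z) \<le> M k" if "\<bar>Re z\<bar> \<le> 1/2" "\<bar>Im z\<bar> = real k" for z
      unfolding f_def M_def by (rule powr_over_sin_norm_le[OF b s that k])
    have "norm ?bot \<le> M k * norm (Complex (1/2) (-real k) - Complex (-1/2) (-real k))"
      by (rule contour_integral_bound_linepath[OF rect(2) M0], rule bd)
         (auto simp: closed_segment_same_Im closed_segment_eq_real_ivl)
    hence bot: "norm ?bot \<le> M k" unfolding len by (simp only: mult_1_right)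
    have "norm ?top \<le> M k * norm (Complex (-1/2) (real k) - Complex (1/2) (real k))"
      by (rule contour_integral_bound_linepath[OF rect(3) M0], rule bd)
         (auto simp: closed_segment_same_Im closed_segment_eq_real_ivl)
    hence top: "norm ?top \<le> M k" unfolding len by (simp only: mult_1_right)
    have "\<i> * (T k b + T k (b + 1)) + ?bot + ?top = 2 * \<i> * (b + 1/2) powr (-s)"
      using rect(1) by (simp only: T_def)
    hence "\<i> * (T k b + T k (b + 1)) - 2 * \<i> * (b + 1/2) powr (-s) = - (?bot + ?top)"
      by (rule alg)
    thus ?thesis using order_trans[OF norm_triangle_ineq add_mono[OF bot top]] by (simp only: norm_minus_cancel)
  qed
  hence "\<forall>\<^sub>F k in sequentially.
      norm (\<i> * (T k b + T k (b + 1)) - 2 * \<i> * (b + 1/2) powr (-s)) \<le> M k + M k"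
    by (intro eventually_sequentiallyI[of 1]) simp
  moreover have "(\<lambda>k. M k + M k) \<longlonglongrightarrow> 0" using tendsto_add[OF M M] by simp
  ultimately have "(\<lambda>k. \<i> * (T k b + T k (b + 1)) - 2 * \<i> * (b + 1/2) powr (-s)) \<longlonglongrightarrow> 0"
    by (rule Lim_null_comparison)
  moreover have "(\<lambda>k. \<i> * (T k b + T k (b + 1)) - 2 * \<i> * (b + 1/2) powr (-s)) \<longlonglongrightarrow>
      \<i> * (sech_power_integral b s + sech_power_integral (b + 1) s) - 2 * \<i> * (b + 1/2) powr (-s)"
    using b by (intro tendsto_diff tendsto_mult[OF tendsto_const] tendsto_add T tendsto_const) auto
  ultimately have "\<i> * (sech_power_integral b s + sech_power_integral (b + 1) s) - 2 * \<i> * (b + 1/2) powr (-s) = 0"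
    by (rule LIMSEQ_unique[symmetric])
  hence "\<i> * (sech_power_integral b s + sech_power_integral (b + 1) s) = \<i> * (2 * (b + 1/2) powr (-s))"
    by simp
  thus ?thesis by simp
qed

section \<open>The alternating Hurwitz zeta function as an integral\<close>

lemma alternating_sum_telescope:
  fixes u :: "nat \<Rightarrow> complex"
  shows "(\<Sum>k<N. (-1) ^ k * (u k + u (Suc k))) = u 0 - (-1) ^ N * u N"
  by (induction N) (auto simp: algebra_simps)

text \<open>
  By the functional equation the \<open>k\<close>-th term is \<open>(-1)^k (J(b + k) + J(b + k + 1)) / 2\<close>, where \<open>J\<close> is
  the integral as a function of its base point, so the series telescopes.
\<close>

lemma sech_power_integral_alternating_series:
  assumes b: "Re b > 0" and s: "Re s > 0"
  shows "(\<lambda>k. (-1) ^ k / (of_nat k + (b + 1/2)) powr s) sums (sech_power_integral b s / 2)"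
proof -
  define u where "u = (\<lambda>k. sech_power_integral (b + of_nat k) s / 2)"
  have summand: "(-1) ^ k / (of_nat k + (b + 1/2)) powr s = (-1) ^ k * (u k + u (Suc k))" for k
  proof -
    have "u k + u (Suc k) = (b + of_nat k + 1/2) powr (-s)"
      using sech_power_integral_plus_shift[of "b + of_nat k" s] b s
      by (simp add: u_def add_ac flip: add_divide_distrib)
    thus ?thesis by (simp add: powr_minus divide_simps add_ac)
  qed
  have "u \<longlonglongrightarrow> 0"
    unfolding u_def using tendsto_divide[OF sech_power_integral_shift_tendsto_0[OF b s] tendsto_const, of 2] by simp
  hence "(\<lambda>N. norm ((-1) ^ N * u N)) \<longlonglongrightarrow> 0"
    using tendsto_norm_zero by (simp add: norm_mult norm_power)
  hence "(\<lambda>N. (-1) ^ N * u N) \<longlonglongrightarrow> 0" by (rule tendsto_norm_zero_cancel)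
  from tendsto_diff[OF tendsto_const[of "u 0"] this]
  show ?thesis unfolding sums_def summand alternating_sum_telescope by (simp add: u_def)
qed

text \<open>
  The integral is an entire function that agrees with the series on \<open>Re z > 0\<close>, and the identity
  theorem leaves no other candidate for the definite description. The condition \<open>Re x > 1/2\<close> is
  what puts the line of integration, through \<open>x - 1/2\<close>, into the right half plane.
\<close>

lemma alt_hurwitz_zeta_eq_sech_power_integral:
  assumes x: "Re x > 1/2"
  shows "alt_hurwitz_zeta s x = sech_power_integral (x - 1/2) s / 2"
proof -
  define F where "F = (\<lambda>s. sech_power_integral (x - 1/2) s / 2)"
  have b: "Re (x - 1/2) > 0" using x by simp
  have hol: "F holomorphic_on UNIV"
    unfolding F_def by (intro holomorphic_intros sech_power_integral_entire[OF b]) auto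
  have series: "(\<lambda>k. (-1) ^ k / (of_nat k + x) powr z) sums F z" if "Re z > 0" for z
    using sech_power_integral_alternating_series[OF b that] by (simp add: F_def)
  have "(THE f. f holomorphic_on UNIV \<and>
     (\<forall>z. Re z > 0 \<longrightarrow> (\<lambda>k. (-1) ^ k / (of_nat k + x) powr z) sums f z)) = F"
  proof (rule the_equality)
    fix f assume f: "f holomorphic_on UNIV \<and>
     (\<forall>z. Re z > 0 \<longrightarrow> (\<lambda>k. (-1) ^ k / (of_nat k + x) powr z) sums f z)"
    show "f = F"
    proof
      fix z
      show "f z = F z"
      proof (rule analytic_continuation_open[of "{z. Re z > 0}" UNIV f F])
        have "1 \<in> {z. Re z > 0}" by simp
        thus "{z. Re z > 0} \<noteq> {}" by blast
        show "f w = F w" if "w \<in> {z. Re z > 0}" for w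
          using that f series[of w] sums_unique2 by blast
      qed (use f hol open_halfspace_Re_gt in auto)
    qed
  qed (use hol series in auto)
  thus ?thesis unfolding alt_hurwitz_zeta_def F_def by simp
qed

section \<open>Reduction of the integrand\<close>

lemma Ln_times_right_half_plane:
  assumes "Re z > 0" "Re w > 0"
  shows "Ln (z * w) = Ln z + Ln w" and "Ln (z / w) = Ln z - Ln w"
proof -
  have nz: "z \<noteq> 0" "w \<noteq> 0" using assms by auto
  have im: "\<bar>Im (Ln z)\<bar> < pi/2" "\<bar>Im (Ln w)\<bar> < pi/2"
    using Re_Ln_pos_lt_imp[OF assms(1)] Re_Ln_pos_lt_imp[OF assms(2)] by auto
  show "Ln (z * w) = Ln z + Ln w"
    by (rule Ln_unique) (use nz im in \<open>auto simp: exp_add abs_less_iff\<close>)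
  show "Ln (z / w) = Ln z - Ln w"
    by (rule Ln_unique) (use nz im in \<open>auto simp: exp_diff abs_less_iff\<close>)
qed

text \<open>
  Euler's formula for the cosine, with \<open>Arctan\<close> written as a difference and the logarithm of
  \<open>a\<^sup>2 + 4v\<^sup>2 = (a + 2iv)(a - 2iv)\<close> as a sum of two logarithms in the right half plane: in each of the
  two exponentials one of the logarithms cancels.
\<close>

lemma cos_Arctan_over_powr:
  assumes a: "Re a > 0"
  shows "cos (s * Arctan (2 * of_real v / a)) / (a\<^sup>2 + 4 * (of_real v)\<^sup>2) powr (s / 2)
    = ((a + 2 * \<i> * of_real v) powr (-s) + (a - 2 * \<i> * of_real v) powr (-s)) / 2"
proof -
  let ?p = "a + 2 * \<i> * of_real v" and ?m = "a - 2 * \<i> * of_real v"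
  have pm: "Re ?p > 0" "Re ?m > 0" using a by auto
  have nz: "?p \<noteq> 0" "?m \<noteq> 0" "a \<noteq> 0" using pm a by (metis less_irrefl zero_complex.sel(1))+
  have prod: "a\<^sup>2 + 4 * (of_real v)\<^sup>2 = ?p * ?m"
    by (simp add: power2_eq_square algebra_simps)
  have quot: "(1 - \<i> * (2 * of_real v / a)) / (1 + \<i> * (2 * of_real v / a)) = ?m / ?p"
  proof -
    have "1 - \<i> * (2 * of_real v / a) = ?m / a" "1 + \<i> * (2 * of_real v / a) = ?p / a"
      using nz(3) by (simp_all add: field_simps)
    thus ?thesis using nz(3) by simp
  qed
  have arg: "s * Arctan (2 * of_real v / a) = \<i> * (s / 2 * (Ln ?m - Ln ?p))"
    unfolding Arctan_def quot Ln_times_right_half_plane(2)[OF pm(2,1)] by simp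
  have den: "(a\<^sup>2 + 4 * (of_real v)\<^sup>2) powr (s / 2) = exp (s / 2 * (Ln ?p + Ln ?m))"
    using nz unfolding prod by (simp add: powr_def Ln_times_right_half_plane(1)[OF pm])
  have cos: "cos (\<i> * (s / 2 * (P - Q))) / exp (s / 2 * (Q + P)) = (exp (-s * Q) + exp (-s * P)) / 2" for P Q
  proof -
    have ring: "- (h * (P - Q)) - h * (Q + P) = - (2 * h) * P"
      "h * (P - Q) - h * (Q + P) = - (2 * h) * Q" for h
      by (simp_all add: algebra_simps)
    have e: "\<i> * (\<i> * (s / 2 * (P - Q))) = - (s / 2 * (P - Q))"
      by (rule complex_i_mult_minus)
    have "cos (\<i> * (s / 2 * (P - Q))) = (exp (- (s / 2 * (P - Q))) + exp (s / 2 * (P - Q))) / 2"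
      unfolding cos_exp_eq e by simp
    hence "cos (\<i> * (s / 2 * (P - Q))) / exp (s / 2 * (Q + P)) =
       (exp (- (s / 2 * (P - Q)) - s / 2 * (Q + P)) + exp (s / 2 * (P - Q) - s / 2 * (Q + P))) / 2"
      by (simp only: exp_diff) (simp add: field_simps)
    also have "- (s / 2 * (P - Q)) - s / 2 * (Q + P) = - s * P" using ring(1)[of "s / 2"] by simp
    also have "s / 2 * (P - Q) - s / 2 * (Q + P) = - s * Q" using ring(2)[of "s / 2"] by simp
    finally show ?thesis by (simp add: add.commute)
  qed
  show ?thesis unfolding arg den cos using nz by (simp add: powr_def)
qed

text \<open>
  Write \<open>iv = (b + iv) - b\<close>, so that \<open>v^(2n) = (-1)^n ((b + iv) - b)^(2n)\<close>, and expand.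
\<close>

lemma power_even_binomial_vertical_line:
  fixes b :: complex
  assumes b: "b \<noteq> 0"
  shows "of_real v ^ (2 * n) = (\<Sum>j = 0..2 * n. (-1) ^ n * b ^ (2 * n) * of_nat (2 * n choose j)
             * (- 1 / b) ^ j * (b + \<i> * of_real v) ^ j)"
proof -
  have "(\<i> * of_real v)\<^sup>2 = - (of_real v)\<^sup>2" by (simp add: power_mult_distrib)
  hence "of_real v ^ (2 * n) = (-1) ^ n * (\<i> * of_real v) ^ (2 * n)"
    by (simp only: power_mult flip: power_mult_distrib) simp
  also have "\<i> * of_real v = -b * (- 1 / b * (b + \<i> * of_real v) + 1)" using b by (simp add: field_simps)
  also have "\<dots> ^ (2 * n) = b ^ (2 * n) * (- 1 / b * (b + \<i> * of_real v) + 1) ^ (2 * n)"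
    by (simp only: power_mult_distrib) simp
  also have "(- 1 / b * (b + \<i> * of_real v) + 1) ^ (2 * n) =
      (\<Sum>j\<le>2 * n. of_nat (2 * n choose j) * (- 1 / b * (b + \<i> * of_real v)) ^ j * 1 ^ (2 * n - j))"
    by (rule binomial_ring)
  finally show ?thesis
    by (simp only: power_mult_distrib atMost_atLeast0 sum_distrib_left power_one mult_1_right mult.assoc)
qed

lemma binomial_coefficient_Gamma:
  assumes "j \<le> m"
  shows "Gamma (of_nat m + 1) / (Gamma (of_nat m - of_nat j + 1) * Gamma (of_nat j + 1))
           = (of_nat (m choose j) :: complex)"
proof -
  have "of_nat m - of_nat j + 1 = (1 + of_nat (m - j) :: complex)" using assms by (simp add: of_nat_diff)
  thus ?thesis using binomial_fact[OF assms, where 'a = complex]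
    by (simp add: Gamma_fact mult.commute add.commute[of _ 1])
qed

text \<open>
  In the binomial expansion of \<open>v^(2n)\<close> each power \<open>(b + iv)^j\<close> merges with \<open>(b + iv)^(-s)\<close>, so the
  integral is a combination of integrals without the factor \<open>v^(2n)\<close>, at the exponents \<open>s - j\<close>.
\<close>

lemma sech_power_moment_has_integral:
  fixes n :: nat and b s :: complex
  assumes b: "Re b > 0"
  defines "p \<equiv> \<lambda>v. of_real v ^ (2 * n) * (b + \<i> * of_real v) powr (-s) / of_real (cosh (pi * v))"
  shows "((\<lambda>v. (p v + p (-v)) / 2) has_integral
     (\<Sum>j = 0..2 * n. (-1) ^ n * b ^ (2 * n) * of_nat (2 * n choose j) * (- 1 / b) ^ j
        * (sech_power_integral b (s - of_nat j) / 2))) {0..}"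
proof -
  define c where "c = (\<lambda>j. (-1) ^ n * b ^ (2 * n) * of_nat (2 * n choose j) * (- 1 / b) ^ j)"
  define g where "g = (\<lambda>j v. (b + \<i> * of_real v) powr (- (s - of_nat j)) / of_real (cosh (pi * v)))"
  have nz: "b \<noteq> 0" "b + \<i> * of_real v \<noteq> 0" for v using b by (auto simp: complex_eq_iff)
  have half: "((\<lambda>v. (g j v + g j (-v)) / 2) has_integral sech_power_integral b (s - of_nat j) / 2) {0..}" for j
  proof -
    obtain C where C: "\<And>v. norm (g j v) \<le> C * exp (- \<bar>v\<bar>)"
      using sech_power_integrand_bound[OF b, of "norm (- (s - of_nat j))"] unfolding g_def by blast
    have "continuous_on UNIV (g j)" unfolding g_def by (rule sech_power_integrand_continuous[OF b])
    from even_part_has_integral[OF this C] show ?thesis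
      by (simp add: sech_power_integral_def g_def)
  qed
  have p: "p v = (\<Sum>j = 0..2 * n. c j * g j v)" for v
  proof -
    have pw: "(b + \<i> * of_real v) ^ j * (b + \<i> * of_real v) powr (-s)
        = (b + \<i> * of_real v) powr (- (s - of_nat j))" for j
    proof -
      have "- (s - of_nat j) = of_nat j + - s" by simp
      thus ?thesis using powr_complexpow[OF nz(2)[of v], of j] by (simp only: powr_add)
    qed
    show ?thesis
      unfolding p_def power_even_binomial_vertical_line[OF nz(1), of v n] sum_distrib_right sum_divide_distrib
      by (intro sum.cong refl) (simp only: c_def g_def mult.assoc pw times_divide_eq_right)
  qed
  have "((\<lambda>v. \<Sum>j = 0..2 * n. c j * ((g j v + g j (-v)) / 2)) has_integral
      (\<Sum>j = 0..2 * n. c j * (sech_power_integral b (s - of_nat j) / 2))) {0..}"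
    by (intro has_integral_sum has_integral_mult_right half) auto
  also have "(\<lambda>v. \<Sum>j = 0..2 * n. c j * ((g j v + g j (-v)) / 2)) = (\<lambda>v. (p v + p (-v)) / 2)"
    unfolding p by (simp add: sum.distrib ring_distribs add_divide_distrib flip: sum_divide_distrib)
  finally show ?thesis by (simp only: c_def)
qed

theorem theorem2:
  fixes n :: nat and s a q :: complex
  assumes "Re a > 0"
    and "q = a / 4 + 1 / 4"
  shows "((\<lambda>v::real.
             of_real v ^ (2 * n) * cos (s * Arctan (2 * of_real v / a)) /
             ((a\<^sup>2 + 4 * (of_real v)\<^sup>2) powr (s / 2) * of_real (cosh (pi * v))))
          has_integral
            (2 powr (- s) * (-1) ^ n * (a / 2) ^ (2 * n) * Gamma (2 * of_nat n + 1) *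
             (\<Sum>j = 0..2 * n.
                (- 2 / a) ^ j * alt_hurwitz_zeta (s - of_nat j) (2 * q) /
                (Gamma (2 * of_nat n - of_nat j + 1) * Gamma (of_nat j + 1))))) {0..}"
proof -
  define b where "b = a / 2"
  have b: "Re b > 0" using assms(1) by (simp add: b_def)
  define p where "p = (\<lambda>v. of_real v ^ (2 * n) * (b + \<i> * of_real v) powr (-s) / of_real (cosh (pi * v)))"
  have powr_double: "(2 * w) powr (-s) = 2 powr (-s) * w powr (-s)" if "Re w > 0" for w
  proof -
    have "w \<noteq> 0" using that by auto
    thus ?thesis using Ln_times_right_half_plane(1)[of 2 w] that
      by (simp add: powr_def distrib_left flip: exp_add)
  qed
  have scale: "(a + 2 * \<i> * of_real v) powr (-s) = 2 powr (-s) * (b + \<i> * of_real v) powr (-s)" for v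
  proof -
    have "a + 2 * \<i> * of_real v = 2 * (b + \<i> * of_real v)" by (simp add: b_def algebra_simps)
    moreover have "Re (b + \<i> * of_real v) > 0" using b by simp
    ultimately show ?thesis by (simp only: powr_double)
  qed
  have integrand: "of_real v ^ (2 * n) * cos (s * Arctan (2 * of_real v / a)) /
             ((a\<^sup>2 + 4 * (of_real v)\<^sup>2) powr (s / 2) * of_real (cosh (pi * v)))
       = 2 powr (-s) * ((p v + p (-v)) / 2)" for v :: real
  proof -
    have "of_real v ^ (2 * n) * cos (s * Arctan (2 * of_real v / a)) /
             ((a\<^sup>2 + 4 * (of_real v)\<^sup>2) powr (s / 2) * of_real (cosh (pi * v)))
       = of_real v ^ (2 * n) / of_real (cosh (pi * v)) *
          (cos (s * Arctan (2 * of_real v / a)) / (a\<^sup>2 + 4 * (of_real v)\<^sup>2) powr (s / 2))"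
      by simp
    also have "\<dots> = 2 powr (-s) * ((p v + p (-v)) / 2)"
      unfolding cos_Arctan_over_powr[OF assms(1)] using scale[of v] scale[of "-v"]
      by (simp add: p_def algebra_simps add_divide_distrib)
    finally show ?thesis .
  qed
  have zeta: "alt_hurwitz_zeta z (2 * q) = sech_power_integral b z / 2" for z
  proof -
    have q: "2 * q = b + 1/2" using assms(2) by (simp add: b_def)
    show ?thesis using alt_hurwitz_zeta_eq_sech_power_integral[of "2 * q" z] b unfolding q by simp
  qed
  have coeff: "Gamma (2 * of_nat n + 1) / (Gamma (2 * of_nat n - of_nat j + 1) * Gamma (of_nat j + 1))
      = (of_nat (2 * n choose j) :: complex)" if "j \<le> 2 * n" for j
    using binomial_coefficient_Gamma[OF that] by simp
  have ba: "- 1 / b = - 2 / a" by (simp add: b_def)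
  have total: "2 powr (-s) * (\<Sum>j = 0..2 * n. (-1) ^ n * b ^ (2 * n) * of_nat (2 * n choose j) * (- 1 / b) ^ j
        * (sech_power_integral b (s - of_nat j) / 2)) =
       2 powr (- s) * (-1) ^ n * (a / 2) ^ (2 * n) * Gamma (2 * of_nat n + 1) *
             (\<Sum>j = 0..2 * n.
                (- 2 / a) ^ j * alt_hurwitz_zeta (s - of_nat j) (2 * q) /
                (Gamma (2 * of_nat n - of_nat j + 1) * Gamma (of_nat j + 1)))"
    unfolding sum_distrib_left zeta ba b_def[symmetric]
  proof (intro sum.cong refl)
    fix j assume "j \<in> {0..2 * n}"
    hence j: "j \<le> 2 * n" by simp
    have regroup: "x * (y * z * (G / D) * d * J) = x * y * z * G * (d * J / D)"
      for x y z G D d J :: complex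
      by simp
    show "2 powr (-s) * ((-1) ^ n * b ^ (2 * n) * of_nat (2 * n choose j) * (- 2 / a) ^ j
            * (sech_power_integral b (s - of_nat j) / 2)) =
          2 powr (-s) * (-1) ^ n * b ^ (2 * n) * Gamma (2 * of_nat n + 1) *
            ((- 2 / a) ^ j * (sech_power_integral b (s - of_nat j) / 2) /
              (Gamma (2 * of_nat n - of_nat j + 1) * Gamma (of_nat j + 1)))"
      unfolding coeff[OF j, symmetric] by (rule regroup)
  qed
  show ?thesis
    unfolding integrand total[symmetric] p_def
    by (intro has_integral_mult_right sech_power_moment_has_integral b)
qed

end
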